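(* Let $m\ge 4$ be a fixed integer. Let $\mathcal{G}$ be an $(n,d,\lambda)$-graph and $U$ a set of vertices of $\mathcal{G}$ with $\lambda\cdot\frac{n}{d}=o(|U|)$. Let $C_m(U)$ denote the number of (labeled, possibly degenerate) cycles of length $m$ with vertices in $U$. Then $$\left|C_m(U)-\frac{|U|^m d^m}{n^m}\right|=O\left(\frac{\lambda |U|^{m-1}d^{m-1}}{n^{m-1}}+\frac{\lambda^{m-2}|U|^2 d}{n}\right).$$ Explicitly: for any sequence of $(n_j,d_j,\lambda_j)$-graphs $\mathcal{G}_j$ and nonempty vertex sets $U_j\subset V(\mathcal{G}_j)$ with $\frac{\lambda_j n_j}{d_j|U_j|}\to 0$ as $j\to\infty$, there is a constant $C$ such that for all sufficiently large $j$ the left-hand side (for $\mathcal{G}_j,U_j$) is at most $C$ times the quantity inside $O(\cdot)$.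
   Context: An $(n,d,\lambda)$-graph is a finite undirected $d$-regular graph on $n$ vertices such that all eigenvalues of its adjacency matrix other than the trivial eigenvalue $d$ (one copy, belonging to the constant eigenvector) have absolute value at most $\lambda$. A (labeled, possibly degenerate) cycle of length $m$ in $U$ is any sequence $(v_1,\dots,v_m)$ of vertices of $U$ (repetitions allowed) with $v_i\sim v_{i+1}$ for $1\le i\le m-1$ and $v_m\sim v_1$. *)

theory Defs
  imports
    "Graph_Theory.Pair_Digraph"
    "Jordan_Normal_Form.Char_Poly"
begin

text \<open>A finite simple undirected graph is a \<open>pair_graph\<close>: a finite, loop-free digraph whose arc set
  is a symmetric relation; adjacency of \<open>u\<close> and \<open>v\<close> is \<open>(u, v) \<in> parcs G\<close>.\<close>

definition adjacency_matrix :: "'a list \<Rightarrow> 'a pair_pre_digraph \<Rightarrow> real mat" where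
  "adjacency_matrix vs G =
     mat (length vs) (length vs) (\<lambda>(i, j). if (vs ! i, vs ! j) \<in> parcs G then 1 else 0)"

text \<open>The real roots of the characteristic polynomial with multiplicity are all the eigenvalues, as
  the adjacency matrix is real symmetric; multiset difference discards a single copy of \<open>d\<close>, so a
  further copy (e.g. for a disconnected graph) still has to be bounded by \<open>lam\<close>. The enumeration \<open>vs\<close>
  of the vertices is immaterial: different enumerations give matrices similar by a permutation.\<close>

definition ndl_graph :: "nat \<Rightarrow> nat \<Rightarrow> real \<Rightarrow> 'a pair_pre_digraph \<Rightarrow> bool" where
  "ndl_graph n d lam G \<longleftrightarrow>
     pair_graph G \<and> card (pverts G) = n \<and>
     (\<forall>v \<in> pverts G. out_degree G v = d) \<and>
     (\<forall>vs. distinct vs \<and> set vs = pverts G \<longrightarrow>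
        (\<forall>\<mu> \<in># proots (char_poly (adjacency_matrix vs G)) - {#real d#}. \<bar>\<mu>\<bar> \<le> lam))"

text \<open>Vertices may repeat, and cycles are labeled: rotations and reversals count separately.\<close>

definition cycles_in :: "'a pair_pre_digraph \<Rightarrow> 'a set \<Rightarrow> nat \<Rightarrow> 'a list set" where
  "cycles_in G U m =
     {vs. length vs = m \<and> set vs \<subseteq> U \<and> (\<forall>i < m. (vs ! i, vs ! (Suc i mod m)) \<in> parcs G)}"

end

theory Submission
  imports
    Defs
    "HOL-Analysis.L2_Norm"
    "HOL-Analysis.Function_Topology"
begin

text \<open>Write the adjacency kernel as \<open>A = E + d/n\<close> on the vertex set. Subtracting \<open>d/n\<close>
  replaces one eigenvalue \<open>d\<close> by \<open>0\<close>, so \<open>E\<close> has operator norm at most \<open>\<lambda>\<close>, and so has its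
  restriction to \<open>U\<close>. The number of cycles is the trace of \<open>A\<^sub>U ^ m\<close>. With \<open>D = d |U| / n\<close>, exchanging one factor
  \<open>A\<^sub>U\<close> for \<open>E\<^sub>U\<close> at a time splits this trace into \<open>D ^ m\<close>, at most \<open>m\<close> mixed terms of size
  \<open>O(\<lambda> D ^ (m - 1))\<close>, each of them an inner product of iterates of the constant function, and the trace
  of \<open>E\<^sub>U ^ m\<close>. The latter is at most \<open>\<lambda> ^ (m - 2)\<close> times the squared Frobenius norm of \<open>E\<^sub>U\<close>, which is
  at most \<open>3 |U|\<^sup>2 d / n\<close> because \<open>\<lambda> \<le> D\<close> eventually.\<close>

section \<open>Operators given by real kernels on a finite set\<close>

text \<open>Only the values of \<open>f\<close> on \<open>S\<close> enter, yet the result is a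
  function on the whole type, so iterates need no extension by zero.\<close>

definition kernel_op :: "'a set \<Rightarrow> ('a \<Rightarrow> 'a \<Rightarrow> real) \<Rightarrow> ('a \<Rightarrow> real) \<Rightarrow> 'a \<Rightarrow> real" where
  "kernel_op S K f u = (\<Sum>v\<in>S. K u v * f v)"

section \<open>Linearity, self-adjointness and norm growth of kernel operators\<close>

lemma kernel_op_add_scaled:
  "kernel_op S K (\<lambda>u. f u + a * g u) = (\<lambda>u. kernel_op S K f u + a * kernel_op S K g u)"
  by (simp add: kernel_op_def fun_eq_iff sum.distrib sum_distrib_left algebra_simps)

lemma kernel_op_funpow_add_scaled:
  "(kernel_op S K ^^ k) (\<lambda>u. f u + a * g u)
     = (\<lambda>u. (kernel_op S K ^^ k) f u + a * (kernel_op S K ^^ k) g u)"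
  by (induction k) (simp_all add: kernel_op_add_scaled)

lemma kernel_op_self_adjoint:
  assumes "\<And>u v. u \<in> S \<Longrightarrow> v \<in> S \<Longrightarrow> K u v = K v u"
  shows "(\<Sum>u\<in>S. f u * kernel_op S K g u) = (\<Sum>u\<in>S. kernel_op S K f u * g u)"
proof -
  have "(\<Sum>u\<in>S. f u * kernel_op S K g u) = (\<Sum>u\<in>S. \<Sum>v\<in>S. f u * K u v * g v)"
    by (simp add: kernel_op_def sum_distrib_left mult.assoc)
  also have "\<dots> = (\<Sum>v\<in>S. \<Sum>u\<in>S. f u * K u v * g v)"
    by (rule sum.swap)
  also have "\<dots> = (\<Sum>v\<in>S. kernel_op S K f v * g v)"
    unfolding kernel_op_def sum_distrib_right
    by (intro sum.cong refl) (simp add: assms mult.commute)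
  finally show ?thesis .
qed

lemma kernel_op_funpow_self_adjoint:
  assumes "\<And>u v. u \<in> S \<Longrightarrow> v \<in> S \<Longrightarrow> K u v = K v u"
  shows "(\<Sum>u\<in>S. f u * (kernel_op S K ^^ k) g u) = (\<Sum>u\<in>S. (kernel_op S K ^^ k) f u * g u)"
proof (induction k arbitrary: f)
  case (Suc k)
  show ?case
    using kernel_op_self_adjoint[where f = f and g = "(kernel_op S K ^^ k) g" and K = K and S = S] assms
      Suc.IH[of "kernel_op S K f"]
    by (simp add: funpow_swap1[of _ _ f])
qed simp

lemma kernel_op_funpow_bound:
  assumes "\<And>f. L2_set (kernel_op S K f) S \<le> b * L2_set f S" and "b \<ge> 0"
  shows "L2_set ((kernel_op S K ^^ k) f) S \<le> b ^ k * L2_set f S"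
proof (induction k)
  case (Suc k)
  have "L2_set ((kernel_op S K ^^ Suc k) f) S \<le> b * L2_set ((kernel_op S K ^^ k) f) S"
    using assms(1) by simp
  also have "\<dots> \<le> b * (b ^ k * L2_set f S)"
    by (rule mult_left_mono[OF Suc.IH assms(2)])
  finally show ?case by (simp add: mult.assoc)
qed simp

lemma abs_sum_mult_le_L2_set:
  "\<bar>\<Sum>u\<in>S. f u * g u\<bar> \<le> L2_set f S * L2_set g S"
proof -
  have "\<bar>\<Sum>u\<in>S. f u * g u\<bar> \<le> (\<Sum>u\<in>S. \<bar>f u\<bar> * \<bar>g u\<bar>)"
    using sum_abs[of "\<lambda>u. f u * g u" S] by (simp add: abs_mult)
  also have "\<dots> \<le> L2_set f S * L2_set g S"
    by (rule L2_set_mult_ineq)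
  finally show ?thesis .
qed

lemma kernel_op_point_mass:
  assumes "finite S" "w \<in> S"
  shows "kernel_op S K (\<lambda>v. of_bool (v = w)) u = K u w"
  using assms by (simp add: kernel_op_def)

lemma sum_mult_point_mass:
  fixes f :: "'a \<Rightarrow> real"
  assumes "finite S" "w \<in> S"
  shows "(\<Sum>u\<in>S. f u * of_bool (u = w)) = f w"
    and "(\<Sum>u\<in>S. of_bool (u = w) * f u) = f w"
  using assms by simp_all

section \<open>Traces of powers under a constant perturbation\<close>

text \<open>In the application \<open>S\<close> is a vertex set \<open>U\<close>, \<open>K\<close>
  the adjacency kernel, \<open>c\<close> is d / n and \<open>\<theta>\<close> is \<open>lam\<close>.
  The assumption \<open>theta_le\<close> holds eventually by the size condition on \<open>U\<close>;
  it allows surplus factors \<open>\<theta>\<close> to be traded for \<open>D\<close>.\<close>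

locale constant_perturbation =
  fixes S :: "'a set" and K E :: "'a \<Rightarrow> 'a \<Rightarrow> real" and c \<theta> :: real
  assumes finite_S: "finite S"
    and K_eq: "\<And>u v. K u v = E u v + c"
    and E_sym: "\<And>u v. u \<in> S \<Longrightarrow> v \<in> S \<Longrightarrow> E u v = E v u"
    and E_bound: "\<And>f. L2_set (kernel_op S E f) S \<le> \<theta> * L2_set f S"
    and c_nonneg: "0 \<le> c"
    and theta_nonneg: "0 \<le> \<theta>"
    and theta_le: "\<theta> \<le> c * real (card S)"
begin

abbreviation "D \<equiv> c * real (card S)"
abbreviation "ones \<equiv> \<lambda>_::'a. 1::real"
abbreviation "\<delta> w \<equiv> \<lambda>v::'a. of_bool (v = w) :: real"
abbreviation "T \<equiv> kernel_op S K"
abbreviation "L \<equiv> kernel_op S E"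

section \<open>Norm bounds and walk counts for the perturbed operator\<close>

lemma K_sym: "u \<in> S \<Longrightarrow> v \<in> S \<Longrightarrow> K u v = K v u"
  by (simp add: K_eq E_sym)

lemma D_nonneg: "0 \<le> D"
  using c_nonneg by simp

lemma T_eq: "T f = (\<lambda>u. L f u + (c * sum f S) * ones u)"
  by (simp add: kernel_op_def fun_eq_iff K_eq sum.distrib sum_distrib_left algebra_simps)

lemma L2_one: "L2_set ones S = sqrt (card S)"
  by (simp add: L2_set_constant)

text \<open>The factor 2 comes from two summands of norm at most \<open>D\<close> each:
  \<open>L\<close>, by \<open>theta_le\<close>, and the constant kernel, by Cauchy-Schwarz.\<close>

lemma T_bound: "L2_set (T f) S \<le> (2 * D) * L2_set f S"
proof -
  have "\<bar>sum f S\<bar> \<le> L2_set f S * sqrt (card S)"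
    using abs_sum_mult_le_L2_set[of f ones S] by (simp add: L2_one)
  then have "c * \<bar>sum f S\<bar> * sqrt (card S) \<le> c * (L2_set f S * sqrt (card S)) * sqrt (card S)"
    by (intro mult_right_mono mult_left_mono c_nonneg) auto
  also have "\<dots> = D * L2_set f S" by simp
  finally have "L2_set (\<lambda>u. (c * sum f S) * ones u) S \<le> D * L2_set f S"
    using c_nonneg by (simp add: L2_set_constant abs_mult mult.commute)
  moreover have "L2_set (L f) S \<le> D * L2_set f S"
    using E_bound[of f] mult_right_mono[OF theta_le, of "L2_set f S"] by simp
  ultimately show ?thesis
    unfolding T_eq using L2_set_triangle_ineq[of "L f" "\<lambda>u. (c * sum f S) * ones u" S] by simp
qed

lemma mixed_inner_bound:
  "\<bar>\<Sum>u\<in>S. (L ^^ l) ones u * (T ^^ k) ones u\<bar> \<le> \<theta> ^ l * (2 * D) ^ k * card S"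
proof -
  have "\<bar>\<Sum>u\<in>S. (L ^^ l) ones u * (T ^^ k) ones u\<bar> \<le> L2_set ((L ^^ l) ones) S * L2_set ((T ^^ k) ones) S"
    by (rule abs_sum_mult_le_L2_set)
  also have "\<dots> \<le> (\<theta> ^ l * L2_set ones S) * ((2 * D) ^ k * L2_set ones S)"
    using D_nonneg theta_nonneg c_nonneg
    by (intro mult_mono kernel_op_funpow_bound E_bound T_bound mult_nonneg_nonneg L2_set_nonneg) auto
  also have "\<dots> = \<theta> ^ l * (2 * D) ^ k * (sqrt (card S) * sqrt (card S))"
    by (simp only: L2_one mult_ac)
  finally show ?thesis by simp
qed

text \<open>Moving one factor \<open>T\<close> onto \<open>ones\<close> and using
  \<open>T ones = L ones + D\<close> makes the error at \<open>Suc k\<close> a mixed inner product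
  plus \<open>D\<close> times the error at \<open>k\<close>. Both parts have the same bound, hence
  the doubling. The factor \<open>D\<close> on the left stands in for an exponent
  \<open>k - 1\<close> on the right, which would be wrong at \<open>k = 0\<close>.\<close>

lemma walk_count_bound:
  "D * \<bar>sum ((T ^^ k) ones) S - card S * D ^ k\<bar> \<le> 2 ^ k * D ^ k * \<theta> * card S"
proof (induction k)
  case (Suc k)
  have "sum ((T ^^ Suc k) ones) S = (\<Sum>u\<in>S. (T ^^ Suc k) ones u * ones u)" by simp
  also have "\<dots> = (\<Sum>u\<in>S. T ones u * (T ^^ k) ones u)"
    using kernel_op_self_adjoint[OF K_sym, where f = ones and g = "(T ^^ k) ones" and S = S]
    by (simp add: mult.commute)
  also have "\<dots> = (\<Sum>u\<in>S. L ones u * (T ^^ k) ones u) + D * sum ((T ^^ k) ones) S"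
    by (simp add: T_eq[of ones] algebra_simps sum.distrib sum_distrib_left)
  finally have "sum ((T ^^ Suc k) ones) S - card S * D ^ Suc k
      = (\<Sum>u\<in>S. L ones u * (T ^^ k) ones u) + D * (sum ((T ^^ k) ones) S - card S * D ^ k)"
    by (simp add: algebra_simps)
  then have "\<bar>sum ((T ^^ Suc k) ones) S - card S * D ^ Suc k\<bar>
      \<le> \<bar>\<Sum>u\<in>S. L ones u * (T ^^ k) ones u\<bar> + \<bar>D * (sum ((T ^^ k) ones) S - card S * D ^ k)\<bar>"
    by (simp only: abs_triangle_ineq)
  also have "\<dots> \<le> \<theta> * (2 * D) ^ k * card S + D * \<bar>sum ((T ^^ k) ones) S - card S * D ^ k\<bar>"
    using mixed_inner_bound[of 1 k]
    by (intro add_mono) (simp, simp only: abs_mult_pos'[OF D_nonneg] order_refl)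
  also have "\<dots> \<le> 2 ^ Suc k * D ^ k * \<theta> * card S"
    using Suc.IH by (simp add: power_mult_distrib algebra_simps)
  finally have "D * \<bar>sum ((T ^^ Suc k) ones) S - card S * D ^ Suc k\<bar>
      \<le> D * (2 ^ Suc k * D ^ k * \<theta> * card S)"
    by (rule mult_left_mono[OF _ D_nonneg])
  then show ?case by (simp add: algebra_simps)
qed (use D_nonneg theta_nonneg in simp)

text \<open>The trace of \<open>T ^^ k\<close> composed with \<open>L ^^ l\<close>; applying an
  operator to \<open>\<delta> w\<close> and evaluating at \<open>w\<close> reads off a diagonal
  entry.\<close>

definition mixed_trace :: "nat \<Rightarrow> nat \<Rightarrow> real" where
  "mixed_trace k l = (\<Sum>w\<in>S. (T ^^ k) ((L ^^ l) (\<delta> w)) w)"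

text \<open>The difference of \<open>T\<close> and \<open>L\<close> has rank one: it sends
  \<open>f\<close> to the constant \<open>c * sum f S\<close>. The trace therefore collapses to an
  inner product, once self-adjointness has moved \<open>L ^^ l\<close> from the point mass to
  \<open>ones\<close>.\<close>

lemma mixed_trace_step:
  "mixed_trace (Suc k) l - mixed_trace k (Suc l) = c * (\<Sum>u\<in>S. (L ^^ l) ones u * (T ^^ k) ones u)"
proof -
  have "(T ^^ Suc k) ((L ^^ l) (\<delta> w)) w
      = (T ^^ k) ((L ^^ Suc l) (\<delta> w)) w + c * ((L ^^ l) ones w * (T ^^ k) ones w)" if "w \<in> S" for w
  proof -
    have "sum ((L ^^ l) (\<delta> w)) S = (\<Sum>u\<in>S. ones u * (L ^^ l) (\<delta> w) u)" by simp
    also have "\<dots> = (\<Sum>u\<in>S. (L ^^ l) ones u * \<delta> w u)"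
      by (rule kernel_op_funpow_self_adjoint[OF E_sym])
    also have "\<dots> = (L ^^ l) ones w"
      by (rule sum_mult_point_mass(1)[OF finite_S that])
    finally have s: "sum ((L ^^ l) (\<delta> w)) S = (L ^^ l) ones w" .
    have "(T ^^ Suc k) ((L ^^ l) (\<delta> w)) = (T ^^ k) (T ((L ^^ l) (\<delta> w)))"
      by (simp add: funpow_swap1)
    also have "\<dots> = (\<lambda>u. (T ^^ k) ((L ^^ Suc l) (\<delta> w)) u + c * (L ^^ l) ones w * (T ^^ k) ones u)"
      by (simp only: T_eq[of "(L ^^ l) (\<delta> w)"] s kernel_op_funpow_add_scaled) simp
    finally show ?thesis by simp
  qed
  then show ?thesis
    by (simp add: mixed_trace_def sum.distrib sum_distrib_left)
qed

text \<open>Only the exchange with \<open>l = 0\<close> produces the main term \<open>D ^ m\<close>,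
  through the walk count. For \<open>l > 0\<close> the whole difference is an error term.\<close>

lemma mixed_trace_step_bound:
  assumes "Suc k + l = m"
  shows "\<bar>mixed_trace (Suc k) l - mixed_trace k (Suc l) - of_bool (l = 0) * D ^ m\<bar>
           \<le> 2 ^ m * \<theta> * D ^ (m - 1)"
proof (cases "l = 0")
  case True
  let ?a = "sum ((T ^^ k) ones) S"
  have m: "m = Suc k" using assms True by simp
  have "\<bar>c * ?a - D ^ m\<bar> * card S = D * \<bar>?a - card S * D ^ k\<bar>"
  proof -
    have "(c * ?a - D ^ m) * card S = D * (?a - card S * D ^ k)"
      by (simp add: m algebra_simps)
    then show ?thesis using D_nonneg
      by (metis abs_mult abs_of_nonneg of_nat_0_le_iff)
  qed
  also have "\<dots> \<le> (2 ^ k * D ^ k * \<theta>) * card S"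
    using walk_count_bound[of k] by simp
  finally have *: "\<bar>c * ?a - D ^ m\<bar> * card S \<le> (2 ^ k * D ^ k * \<theta>) * card S" .
  have "\<bar>c * ?a - D ^ m\<bar> \<le> 2 ^ k * D ^ k * \<theta>"
  \<comment> \<open>Cancelling \<open>card S\<close> requires it to be nonzero. For empty
    \<open>S\<close> the sum and \<open>D ^ m\<close> both vanish, since \<open>m\<close> is
    positive.\<close>
  proof (cases "card S = 0")
    case True
    then have "S = {}" using finite_S by simp
    then show ?thesis using theta_nonneg m by simp
  next
    case False
    then show ?thesis using * by simp
  qed
  also have "\<dots> \<le> 2 ^ m * D ^ k * \<theta>"
    using theta_nonneg D_nonneg by (intro mult_right_mono) (auto simp: m)
  finally show ?thesis
    using True mixed_trace_step[of k 0] by (simp add: m mult_ac)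
next
  case False
  then obtain l' where l: "l = Suc l'" by (cases l) auto
  have "\<bar>mixed_trace (Suc k) l - mixed_trace k (Suc l)\<bar> \<le> c * (\<theta> ^ l * (2 * D) ^ k * card S)"
    unfolding mixed_trace_step abs_mult
    using mixed_inner_bound[of l k] c_nonneg by (simp add: mult_left_mono)
  also have "\<dots> = \<theta> * \<theta> ^ l' * 2 ^ k * D ^ Suc k"
    by (simp add: l power_mult_distrib mult_ac)
  \<comment> \<open>One factor \<open>\<theta>\<close> is kept; the other \<open>l'\<close> are
    replaced by \<open>D\<close>.\<close>
  also have "\<dots> \<le> \<theta> * D ^ l' * 2 ^ m * D ^ Suc k"
    using theta_nonneg theta_le D_nonneg c_nonneg assms
    by (intro mult_mono power_mono power_increasing mult_nonneg_nonneg) auto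
  also have "\<dots> = 2 ^ m * \<theta> * D ^ (Suc k + l')"
    by (simp only: power_add mult_ac)
  also have "Suc k + l' = m - 1" using assms l by simp
  finally show ?thesis using False by simp
qed

text \<open>Telescoping over the first \<open>k\<close> exchanges. The condition
  \<open>k \<ge> 1\<close> ensures that the exchange carrying \<open>D ^ m\<close> is among them;
  \<open>l\<close> merely expresses \<open>k \<le> m\<close>.\<close>

lemma mixed_trace_diff_bound:
  assumes "k + l = m" and "k \<ge> 1"
  shows "\<bar>mixed_trace m 0 - mixed_trace (m - k) k - D ^ m\<bar> \<le> k * (2 ^ m * \<theta> * D ^ (m - 1))"
  using assms
proof (induction k arbitrary: l)
  case (Suc k)
  have st: "\<bar>mixed_trace (Suc (m - Suc k)) k - mixed_trace (m - Suc k) (Suc k)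
      - of_bool (k = 0) * D ^ m\<bar> \<le> 2 ^ m * \<theta> * D ^ (m - 1)"
    using Suc.prems by (intro mixed_trace_step_bound) auto
  have mk: "Suc (m - Suc k) = m - k" using Suc.prems by simp
  show ?case
  proof (cases "k = 0")
    case True
    then show ?thesis using st mk by simp
  next
    case False
    then have "\<bar>mixed_trace m 0 - mixed_trace (m - k) k - D ^ m\<bar> \<le> k * (2 ^ m * \<theta> * D ^ (m - 1))"
      using Suc.IH[of "Suc l"] Suc.prems by simp
    then show ?thesis
      using st False abs_triangle_ineq[of "mixed_trace m 0 - mixed_trace (m - k) k - D ^ m"
          "mixed_trace (m - k) k - mixed_trace (m - Suc k) (Suc k)"]
      unfolding mk by (simp add: distrib_right algebra_simps)
  qed
qed simp

text \<open>Self-adjointness turns a diagonal entry into the inner product of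
  \<open>L (\<delta> w)\<close> with its image under \<open>L ^^ (m - 2)\<close>. Cauchy-Schwarz
  gives the power of \<open>\<theta>\<close>, and the squared norms of the columns
  \<open>L (\<delta> w)\<close> add up to the squared Frobenius norm.\<close>

lemma trace_power_E_bound:
  assumes "m \<ge> 2"
  shows "\<bar>\<Sum>w\<in>S. (L ^^ m) (\<delta> w) w\<bar> \<le> \<theta> ^ (m - 2) * (\<Sum>w\<in>S. \<Sum>u\<in>S. (E u w)\<^sup>2)"
proof -
  obtain k where m: "m = Suc (Suc k)"
    using assms by (metis add_2_eq_Suc le_Suc_ex)
  have "\<bar>(L ^^ m) (\<delta> w) w\<bar> \<le> \<theta> ^ k * (\<Sum>u\<in>S. (E u w)\<^sup>2)" if "w \<in> S" for w
  proof -
    have "(L ^^ m) (\<delta> w) w = (\<Sum>u\<in>S. \<delta> w u * L ((L ^^ k) (L (\<delta> w))) u)"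
      by (simp only: sum_mult_point_mass(2)[OF finite_S that] m funpow.simps o_apply funpow_swap1)
    also have "\<dots> = (\<Sum>u\<in>S. L (\<delta> w) u * (L ^^ k) (L (\<delta> w)) u)"
      by (rule kernel_op_self_adjoint[OF E_sym])
    finally have "\<bar>(L ^^ m) (\<delta> w) w\<bar> \<le> L2_set (L (\<delta> w)) S * L2_set ((L ^^ k) (L (\<delta> w))) S"
      by (simp only: abs_sum_mult_le_L2_set)
    also have "\<dots> \<le> L2_set (L (\<delta> w)) S * (\<theta> ^ k * L2_set (L (\<delta> w)) S)"
      by (rule mult_left_mono[OF kernel_op_funpow_bound[OF E_bound theta_nonneg] L2_set_nonneg])
    also have "\<dots> = \<theta> ^ k * (L2_set (L (\<delta> w)) S)\<^sup>2"
      by (simp add: power2_eq_square)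
    also have "(L2_set (L (\<delta> w)) S)\<^sup>2 = (\<Sum>u\<in>S. (E u w)\<^sup>2)"
      by (simp add: L2_set_def sum_nonneg kernel_op_point_mass[OF finite_S that])
    finally show ?thesis .
  qed
  then have "(\<Sum>w\<in>S. \<bar>(L ^^ m) (\<delta> w) w\<bar>) \<le> (\<Sum>w\<in>S. \<theta> ^ k * (\<Sum>u\<in>S. (E u w)\<^sup>2))"
    by (rule sum_mono)
  also have "\<dots> = \<theta> ^ (m - 2) * (\<Sum>w\<in>S. \<Sum>u\<in>S. (E u w)\<^sup>2)"
    by (simp add: sum_distrib_left m)
  finally show ?thesis
    by (rule order_trans[OF sum_abs])
qed

lemma trace_power_bound:
  assumes "m \<ge> 2"
  shows "\<bar>(\<Sum>w\<in>S. (T ^^ m) (\<delta> w) w) - D ^ m\<bar>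
    \<le> m * 2 ^ m * \<theta> * D ^ (m - 1) + \<theta> ^ (m - 2) * (\<Sum>w\<in>S. \<Sum>u\<in>S. (E u w)\<^sup>2)"
  using mixed_trace_diff_bound[of m 0 m] trace_power_E_bound[OF assms] assms
  by (simp add: mixed_trace_def mult.assoc)

text \<open>For the adjacency kernel this bounds the number of ordered adjacent pairs in
  \<open>S\<close>, which controls the Frobenius norm of \<open>E\<close>.\<close>

lemma sum_row_bound: "(\<Sum>u\<in>S. \<Sum>v\<in>S. K u v) \<le> 2 * D * card S"
proof -
  have "(\<Sum>u\<in>S. \<Sum>v\<in>S. K u v) = (\<Sum>u\<in>S. ones u * T ones u)"
    by (simp add: kernel_op_def)
  also have "\<dots> \<le> L2_set ones S * L2_set (T ones) S"
    by (rule order_trans[OF abs_ge_self abs_sum_mult_le_L2_set])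
  also have "\<dots> \<le> L2_set ones S * (2 * D * L2_set ones S)"
    by (intro mult_left_mono T_bound) auto
  also have "\<dots> = 2 * D * (sqrt (card S) * sqrt (card S))"
    by (simp only: L2_one mult_ac)
  finally show ?thesis by simp
qed

end

section \<open>Extremal eigenvalues of symmetric kernels\<close>

text \<open>First-order condition: the quadratic vanishes at \<open>t = 0\<close> and has its
  minimum there, so its derivative \<open>2 * b\<close> is zero.\<close>

lemma linear_coeff_eq_0:
  fixes a b :: real
  assumes "\<And>t. 0 \<le> 2 * t * b + t\<^sup>2 * a"
  shows "b = 0"
proof (rule ccontr)
  assume "b \<noteq> 0"
  \<comment> \<open>Positive and larger than \<open>a\<close> whatever the sign of \<open>a\<close>,
    so that at \<open>t = - b / A\<close> the linear term outweighs the quadratic one.\<close>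
  define A where "A = \<bar>a\<bar> + 1"
  have A: "A > 0" "a < A" by (auto simp: A_def)
  have "2 * (- b / A) * b + (- b / A)\<^sup>2 * a = (b\<^sup>2 / A) * (a / A - 2)"
    using A by (simp add: power2_eq_square right_diff_distrib)
  moreover have "(b\<^sup>2 / A) * (a / A - 2) < 0"
    using A \<open>b \<noteq> 0\<close> by (intro mult_pos_neg) (auto simp: field_simps)
  ultimately show False using assms[of "- b / A"] by simp
qed

text \<open>Vanishing off \<open>V\<close> makes this a closed subset of a product of compact sets,
  \<open>{-1..1}\<close> on \<open>V\<close> and \<open>{0}\<close> elsewhere, so Tychonoff applies
  even over an infinite type.\<close>

lemma compact_unit_sphere:
  fixes V :: "'a set"
  assumes "finite V"
  shows "compact {f :: 'a \<Rightarrow> real. (\<forall>u. u \<notin> V \<longrightarrow> f u = 0) \<and> (\<Sum>u\<in>V. (f u)\<^sup>2) = 1}" (is "compact ?X")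
proof -
  let ?B = "\<lambda>u. if u \<in> V then {-1..1::real} else {0}"
  have "compactin (product_topology (\<lambda>_. euclidean) UNIV) (PiE UNIV ?B)"
    unfolding compactin_PiE by auto
  then have cpt: "compact (PiE UNIV ?B)"
    by (simp add: euclidean_product_topology)
  have "closed {f :: 'a \<Rightarrow> real. (\<Sum>u\<in>V. (f u)\<^sup>2) = 1}"
    by (intro closed_Collect_eq continuous_intros continuous_on_product_coordinates)
  then have "compact (PiE UNIV ?B \<inter> {f. (\<Sum>u\<in>V. (f u)\<^sup>2) = 1})"
    by (rule compact_Int_closed[OF cpt])
  moreover have "PiE UNIV ?B \<inter> {f. (\<Sum>u\<in>V. (f u)\<^sup>2) = 1} = ?X"
  proof (intro equalityI subsetI)
    fix f assume f: "f \<in> ?X"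
    have "\<bar>f u\<bar> \<le> 1" if "u \<in> V" for u
    proof -
      have "(f u)\<^sup>2 \<le> (\<Sum>u\<in>V. (f u)\<^sup>2)"
        using member_le_sum[of u V "\<lambda>u. (f u)\<^sup>2"] that assms by simp
      then show ?thesis using f by (simp add: abs_square_le_1)
    qed
    then show "f \<in> PiE UNIV ?B \<inter> {f. (\<Sum>u\<in>V. (f u)\<^sup>2) = 1}"
      using f by (fastforce simp: abs_le_iff)
  qed (auto simp: PiE_iff split: if_splits)
  ultimately show ?thesis by simp
qed

text \<open>A maximiser \<open>f\<close> of the norm of \<open>K f\<close> on the unit sphere satisfies \<open>K\<^sup>2 f = \<theta>\<^sup>2 f\<close>, hence
  \<open>(K - \<theta>) (K + \<theta>) f = 0\<close>.\<close>

lemma symmetric_kernel_extremal_eigenvalue: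
  fixes V :: "'a set"
  assumes fin: "finite V" and "V \<noteq> {}"
    and sym: "\<And>u v. u \<in> V \<Longrightarrow> v \<in> V \<Longrightarrow> K u v = K v u"
  obtains f \<mu> where "\<exists>u\<in>V. f u \<noteq> 0" "\<forall>u\<in>V. kernel_op V K f u = \<mu> * f u"
    "\<forall>g. L2_set (kernel_op V K g) V \<le> \<bar>\<mu>\<bar> * L2_set g V"
proof -
  let ?L = "kernel_op V K"
  define N where "N g = (\<Sum>u\<in>V. (g u)\<^sup>2)" for g :: "'a \<Rightarrow> real"
  define X where "X = {f :: 'a \<Rightarrow> real. (\<forall>u. u \<notin> V \<longrightarrow> f u = 0) \<and> N f = 1}"
  have N_nonneg: "N g \<ge> 0" for g by (simp add: N_def sum_nonneg)
  have N_expand: "N (\<lambda>u. f u + t * g u) = N f + 2 * t * (\<Sum>u\<in>V. f u * g u) + t\<^sup>2 * N g" for f g t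
    by (simp add: N_def power2_sum power_mult_distrib sum.distrib sum_distrib_left algebra_simps)
  have cpt: "compact X"
    using compact_unit_sphere[OF fin] by (simp add: X_def N_def)
  obtain w where "w \<in> V" using \<open>V \<noteq> {}\<close> by blast
  then have "(\<lambda>u. of_bool (u = w)) \<in> X"
    using fin by (auto simp: X_def N_def of_bool_def if_distrib[of "\<lambda>x. x\<^sup>2"] cong: if_cong)
  then have "X \<noteq> {}" by blast
  have "continuous_on UNIV (\<lambda>f. N (?L f))"
    unfolding N_def kernel_op_def by (intro continuous_intros continuous_on_product_coordinates)
  then have "continuous_on X (\<lambda>f. N (?L f))"
    by (rule continuous_on_subset) simp
  then obtain f where f: "f \<in> X" "\<And>g. g \<in> X \<Longrightarrow> N (?L g) \<le> N (?L f)"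
    using continuous_attains_sup[OF cpt \<open>X \<noteq> {}\<close>] by blast
  define M where "M = N (?L f)"
  have Nf: "N f = 1" using f(1) by (simp add: X_def)
  have max: "N (?L g) \<le> M * N g" for g
  proof (cases "N g = 0")
    case True
    then have "\<And>u. u \<in> V \<Longrightarrow> g u = 0" using fin by (simp add: N_def sum_nonneg_eq_0_iff)
    then show ?thesis using True by (simp add: N_def kernel_op_def)
  next
    case False
    define r where "r = sqrt (N g)"
    have r: "r\<^sup>2 = N g" "r \<noteq> 0" using N_nonneg[of g] False by (simp_all add: r_def)
    let ?h = "\<lambda>u. if u \<in> V then g u / r else 0"
    have "N ?h = N g / r\<^sup>2"
      by (simp add: N_def power_divide sum_divide_distrib)
    then have "?h \<in> X" using r False by (simp add: X_def)
    then have "N (?L ?h) \<le> M" using f(2) by (simp add: M_def)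
    moreover have "?L ?h = (\<lambda>u. ?L g u / r)"
      by (simp add: kernel_op_def fun_eq_iff sum_divide_distrib)
    then have "N (?L ?h) = N (?L g) / r\<^sup>2"
      by (simp add: N_def power_divide sum_divide_distrib)
    ultimately show ?thesis
      using r False N_nonneg[of g] by (simp add: divide_le_eq)
  qed
  \<comment> \<open>The function \<open>M * N g - N (?L g)\<close> of \<open>g\<close> is
    nonnegative and vanishes at \<open>f\<close>, so its first variation at \<open>f\<close> is zero
    in every direction.\<close>
  have crit: "(\<Sum>u\<in>V. (M * f u - ?L (?L f) u) * g u) = 0" for g
  proof -
    have "0 \<le> 2 * t * (M * (\<Sum>u\<in>V. f u * g u) - (\<Sum>u\<in>V. ?L f u * ?L g u)) + t\<^sup>2 * (M * N g - N (?L g))" for t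
      using max[of "\<lambda>u. f u + t * g u"]
      by (simp add: kernel_op_add_scaled N_expand Nf M_def[symmetric] algebra_simps)
    then have "M * (\<Sum>u\<in>V. f u * g u) - (\<Sum>u\<in>V. ?L f u * ?L g u) = 0"
      by (rule linear_coeff_eq_0)
    moreover have "(\<Sum>u\<in>V. ?L f u * ?L g u) = (\<Sum>u\<in>V. ?L (?L f) u * g u)"
      by (rule kernel_op_self_adjoint[OF sym])
    ultimately show ?thesis
      by (simp add: left_diff_distrib sum_subtractf sum_distrib_left mult.assoc)
  qed
  have LL: "?L (?L f) u = M * f u" if "u \<in> V" for u
  proof -
    have "(\<Sum>u\<in>V. (M * f u - ?L (?L f) u)\<^sup>2) = 0"
      using crit[of "\<lambda>u. M * f u - ?L (?L f) u"] by (simp add: power2_eq_square)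
    then show ?thesis using fin that by (simp add: sum_nonneg_eq_0_iff)
  qed
  define \<theta> where "\<theta> = sqrt M"
  have "M \<ge> 0" by (simp add: M_def N_nonneg)
  then have \<theta>: "\<theta> \<ge> 0" "\<theta> * \<theta> = M" by (simp_all add: \<theta>_def)
  have bound: "L2_set (?L g) V \<le> \<theta> * L2_set g V" for g
    using max[of g] by (simp add: L2_set_def N_def \<theta>_def flip: real_sqrt_mult)
  \<comment> \<open>Either \<open>h\<close> is nonzero on \<open>V\<close> and an eigenvector for
    \<open>\<theta>\<close>, or it vanishes there and \<open>f\<close> is an eigenvector for
    \<open>- \<theta>\<close>.\<close>
  define h where "h = (\<lambda>u. ?L f u + \<theta> * f u)"
  show thesis
  proof (cases "\<exists>u\<in>V. h u \<noteq> 0")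
    case True
    have "?L h u = \<theta> * h u" if "u \<in> V" for u
      unfolding h_def kernel_op_add_scaled LL[OF that] \<theta>(2)[symmetric] by (simp add: algebra_simps)
    then show thesis using that[of h \<theta>] True bound \<theta> by simp
  next
    case False
    then have "?L f u = (- \<theta>) * f u" if "u \<in> V" for u
      using that by (fastforce simp: h_def)
    moreover have "\<exists>u\<in>V. f u \<noteq> 0"
    proof (rule ccontr)
      assume "\<not> ?thesis"
      then have "N f = 0" by (simp add: N_def)
      with Nf show False by simp
    qed
    ultimately show thesis using that[of f "- \<theta>"] bound \<theta> by simp
  qed
qed

section \<open>Spectral bound for regular graphs\<close>

text \<open>Conjugation by the unipotent matrix whose first column is constant \<open>1\<close> splits off the
  eigenvector \<open>(1, \<dots>, 1)\<close>.\<close>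

lemma char_poly_constant_row_sum:
  fixes M :: "'a :: comm_ring_1 mat"
  assumes M: "M \<in> carrier_mat (Suc n) (Suc n)"
    and row: "\<And>i. i < Suc n \<Longrightarrow> (\<Sum>j<Suc n. M $$ (i, j)) = c"
  shows "char_poly M = [:- c, 1:] * char_poly (mat n n (\<lambda>(i, j). M $$ (Suc i, Suc j) - M $$ (0, Suc j)))"
    (is "_ = _ * char_poly ?Q")
proof -
  \<comment> \<open>\<open>P\<close> is the unipotent matrix, \<open>R\<close> its inverse and
    \<open>B\<close> the conjugate of \<open>M\<close>. Constant row sums make \<open>M\<close> map
    the first column of \<open>P\<close> to \<open>c\<close> times itself, whence the zero block of
    \<open>B\<close>.\<close>
  define B where "B = four_block_mat (mat 1 1 (\<lambda>_. c)) (mat 1 n (\<lambda>(_, j). M $$ (0, Suc j))) (0\<^sub>m n 1) ?Q"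
  define P :: "'a mat" where
    "P = mat (Suc n) (Suc n) (\<lambda>(i, j). if i = j \<or> j = 0 then 1 else 0)"
  define R :: "'a mat" where
    "R = mat (Suc n) (Suc n) (\<lambda>(i, j). if i = j then 1 else if j = 0 then - 1 else 0)"
  have carrier: "B \<in> carrier_mat (Suc n) (Suc n)" "P \<in> carrier_mat (Suc n) (Suc n)"
    "R \<in> carrier_mat (Suc n) (Suc n)"
    by (auto simp: B_def P_def R_def)
  have head_split: "(\<Sum>k\<in>{0..<Suc n}. f k) = f 0 + (\<Sum>k<n. f (Suc k))" for f :: "nat \<Rightarrow> 'a"
    by (simp only: atLeast0LessThan sum.lessThan_Suc_shift)
  have times: "(X * Y) $$ (i, j) = X $$ (i, 0) * Y $$ (0, j) + (\<Sum>k<n. X $$ (i, Suc k) * Y $$ (Suc k, j))"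
    if "X \<in> carrier_mat (Suc n) (Suc n)" "Y \<in> carrier_mat (Suc n) (Suc n)" "i < Suc n" "j < Suc n"
    for X Y :: "'a mat" and i j
    using that by (simp add: scalar_prod_def head_split del: sum.op_ivl_Suc)
  have B_entries: "B $$ (0, 0) = c" "\<And>i. i < n \<Longrightarrow> B $$ (Suc i, 0) = 0"
    "\<And>j. j < n \<Longrightarrow> B $$ (0, Suc j) = M $$ (0, Suc j)"
    "\<And>i j. i < n \<Longrightarrow> j < n \<Longrightarrow> B $$ (Suc i, Suc j) = M $$ (Suc i, Suc j) - M $$ (0, Suc j)"
    by (auto simp: B_def)
  have P_entries: "P $$ (0, 0) = 1" "\<And>i. i < n \<Longrightarrow> P $$ (Suc i, 0) = 1"
    "\<And>j. j < n \<Longrightarrow> P $$ (0, Suc j) = 0"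
    "\<And>i j. i < n \<Longrightarrow> j < n \<Longrightarrow> P $$ (Suc i, Suc j) = of_bool (i = j)"
    by (auto simp: P_def)
  have R_entries: "R $$ (0, 0) = 1" "\<And>i. i < n \<Longrightarrow> R $$ (Suc i, 0) = - 1"
    "\<And>j. j < n \<Longrightarrow> R $$ (0, Suc j) = 0"
    "\<And>i j. i < n \<Longrightarrow> j < n \<Longrightarrow> R $$ (Suc i, Suc j) = of_bool (i = j)"
    by (auto simp: R_def)
  have delta: "(\<Sum>k<n. of_bool (i = k) * f k) = f i" "(\<Sum>k<n. f k * of_bool (k = i)) = f i"
    if "i < n" for f :: "nat \<Rightarrow> 'a" and i
    using that by (simp_all add: of_bool_def if_distrib[of "\<lambda>x. x * _"] if_distrib[of "\<lambda>x. _ * x"] cong: if_cong)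
  have PR: "P * R = 1\<^sub>m (Suc n)"
  proof (rule eq_matI)
    fix i j assume "i < dim_row (1\<^sub>m (Suc n) :: 'a mat)" "j < dim_col (1\<^sub>m (Suc n) :: 'a mat)"
    then show "(P * R) $$ (i, j) = 1\<^sub>m (Suc n) $$ (i, j)"
      by (cases i; cases j) (auto simp: times carrier P_entries R_entries delta sum_negf)
  qed (use carrier in auto)
  have RP: "R * P = 1\<^sub>m (Suc n)"
  proof (rule eq_matI)
    fix i j assume "i < dim_row (1\<^sub>m (Suc n) :: 'a mat)" "j < dim_col (1\<^sub>m (Suc n) :: 'a mat)"
    then show "(R * P) $$ (i, j) = 1\<^sub>m (Suc n) $$ (i, j)"
      by (cases i; cases j) (auto simp: times carrier P_entries R_entries delta)
  qed (use carrier in auto)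
  have MP: "M * P = P * B"
  proof (rule eq_matI)
    fix i j assume "i < dim_row (P * B)" "j < dim_col (P * B)"
    then have ij: "i < Suc n" "j < Suc n" using carrier by auto
    have row': "M $$ (i, 0) + (\<Sum>k<n. M $$ (i, Suc k)) = c" if "i < Suc n" for i
      using row[OF that] by (simp only: sum.lessThan_Suc_shift)
    show "(M * P) $$ (i, j) = (P * B) $$ (i, j)"
      using ij row'[of i]
      by (cases i; cases j) (auto simp: times carrier M P_entries B_entries delta)
  qed (use carrier M in auto)
  have "M = M * (P * R)" using M PR by simp
  also have "\<dots> = P * B * R" using assoc_mult_mat[OF M carrier(2,3)] MP by simp
  finally have "similar_mat M B"
    using M carrier PR RP by (intro similar_matI[of _ _ P R "Suc n"]) auto
  then have "char_poly M = char_poly B" by (rule char_poly_similar)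
  also have "\<dots> = char_poly (mat 1 1 (\<lambda>_. c)) * char_poly ?Q"
    unfolding B_def by (rule char_poly_four_block_zeros_col) auto
  also have "char_poly (mat 1 1 (\<lambda>_. c)) = [:- c, 1:]"
    by (subst char_poly_upper_triangular[of _ 1]) (auto simp: diag_mat_def)
  finally show ?thesis .
qed

section \<open>From roots of the characteristic polynomial to an operator norm\<close>

abbreviation adjacency :: "'a pair_pre_digraph \<Rightarrow> 'a \<Rightarrow> 'a \<Rightarrow> real" where
  "adjacency G u v \<equiv> of_bool ((u, v) \<in> parcs G)"

lemma ndl_graph_adjacency:
  assumes "ndl_graph n d lam G"
  shows ndl_graph_finite: "finite (pverts G)"
    and ndl_graph_symmetric: "adjacency G u v = adjacency G v u"
    and ndl_graph_loopfree: "(v, v) \<notin> parcs G"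
    and ndl_graph_row_sum: "u \<in> pverts G \<Longrightarrow> (\<Sum>v\<in>pverts G. adjacency G u v) = d"
proof -
  interpret pair_graph G using assms by (simp add: ndl_graph_def)
  show fin: "finite (pverts G)" by (rule pair_finite_verts)
  show "adjacency G u v = adjacency G v u"
    using pair_sym_arcs by (auto simp: symmetric_def sym_def)
  show "(v, v) \<notin> parcs G"
    using no_loops' by blast
  assume u: "u \<in> pverts G"
  have "(\<Sum>v\<in>pverts G. adjacency G u v) = card {v \<in> pverts G. (u, v) \<in> parcs G}"
    using fin by (simp add: Int_def)
  also have "{v \<in> pverts G. (u, v) \<in> parcs G} = snd ` out_arcs (with_proj G) u"
    by (force simp: out_arcs_def dest: in_arcsD2)
  also have "card \<dots> = out_degree (with_proj G) u"
    unfolding out_degree_def by (rule card_image) (auto simp: inj_on_def out_arcs_def)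
  also have "\<dots> = d"
    using assms u by (simp add: ndl_graph_def)
  finally show "(\<Sum>v\<in>pverts G. adjacency G u v) = d" .
qed

text \<open>The adjacency matrix \<open>M\<close> and the centered matrix \<open>N\<close> have
  constant row sums \<open>d\<close> and \<open>0\<close>. Both leave the same reduced matrix
  \<open>Q\<close>, because subtracting the first row cancels the constant d / n. A nonzero
  eigenvalue of \<open>N\<close> is thus a root for \<open>Q\<close>, and these roots are exactly
  those of \<open>M\<close> with one copy of \<open>d\<close> removed.\<close>

lemma ndl_graph_nontrivial_eigenvalue:
  assumes G: "ndl_graph n d lam G"
    and "\<mu> \<noteq> 0"
    and f: "\<exists>u\<in>pverts G. f u \<noteq> 0"
      "\<And>u. u \<in> pverts G \<Longrightarrow> kernel_op (pverts G) (\<lambda>u v. adjacency G u v - d / n) f u = \<mu> * f u"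
  shows "\<bar>\<mu>\<bar> \<le> lam"
proof -
  have fin: "finite (pverts G)" by (rule ndl_graph_finite[OF G])
  have card: "card (pverts G) = n" using G by (simp add: ndl_graph_def)
  obtain vs where vs: "distinct vs" "set vs = pverts G"
    using finite_distinct_list[OF fin] by blast
  have len: "length vs = n" using vs card distinct_card by fastforce
  obtain n' where n: "n = Suc n'"
    using f(1) card fin by (cases n) auto
  have bij: "bij_betw ((!) vs) {..<n} (pverts G)"
    using bij_betw_nth[OF vs(1)] vs len by simp
  have sum_nth: "(\<Sum>j<n. g (vs ! j)) = sum g (pverts G)" for g :: "'a \<Rightarrow> real"
    by (rule sum.reindex_bij_betw[OF bij])
  have nth_in: "vs ! i \<in> pverts G" if "i < n" for i
    using that vs len nth_mem by metis
  define M where "M = adjacency_matrix vs G"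
  define N where "N = mat n n (\<lambda>(i, j). M $$ (i, j) - d / n)"
  have entries: "M $$ (i, j) = adjacency G (vs ! i) (vs ! j)" if "i < n" "j < n" for i j
    using that by (simp add: M_def adjacency_matrix_def len)
  have M: "M \<in> carrier_mat (Suc n') (Suc n')"
    by (simp add: M_def adjacency_matrix_def len n)
  have N: "N \<in> carrier_mat (Suc n') (Suc n')"
    by (simp add: N_def n)
  define Q where "Q = mat n' n' (\<lambda>(i, j). M $$ (Suc i, Suc j) - M $$ (0, Suc j))"
  have rowM: "(\<Sum>j<Suc n'. M $$ (i, j)) = d" if "i < Suc n'" for i
  proof -
    have "(\<Sum>j<n. M $$ (i, j)) = (\<Sum>j<n. adjacency G (vs ! i) (vs ! j))"
      using that n by (intro sum.cong) (auto simp: entries)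
    also have "\<dots> = (\<Sum>v\<in>pverts G. adjacency G (vs ! i) v)"
      by (rule sum_nth)
    also have "\<dots> = d"
      by (rule ndl_graph_row_sum[OF G nth_in]) (use that n in simp)
    finally show ?thesis by (simp only: n)
  qed
  have rowN: "(\<Sum>j<Suc n'. N $$ (i, j)) = 0" if "i < Suc n'" for i
  proof -
    have "(\<Sum>j<Suc n'. N $$ (i, j)) = (\<Sum>j<Suc n'. M $$ (i, j) - d / n)"
      using that by (intro sum.cong) (auto simp: N_def n)
    also have "\<dots> = 0"
      unfolding sum_subtractf rowM[OF that] by (simp add: n)
    finally show ?thesis .
  qed
  have cpM: "char_poly M = [:- d, 1:] * char_poly Q"
    using char_poly_constant_row_sum[OF M rowM] by (simp add: Q_def)
  have "mat n' n' (\<lambda>(i, j). N $$ (Suc i, Suc j) - N $$ (0, Suc j)) = Q"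
    by (rule eq_matI) (auto simp: Q_def N_def n)
  then have cpN: "char_poly N = [:0, 1:] * char_poly Q"
    using char_poly_constant_row_sum[OF N rowN] by simp
  define w where "w = vec n (\<lambda>i. f (vs ! i))"
  have "N *\<^sub>v w = \<mu> \<cdot>\<^sub>v w"
  proof (rule eq_vecI)
    fix i assume "i < dim_vec (\<mu> \<cdot>\<^sub>v w)"
    then have i: "i < n" by (simp add: w_def)
    have "(N *\<^sub>v w) $ i = (\<Sum>j<n. (adjacency G (vs ! i) (vs ! j) - d / n) * f (vs ! j))"
      using i by (auto simp: N_def w_def scalar_prod_def entries atLeast0LessThan intro!: sum.cong)
    also have "\<dots> = \<mu> * f (vs ! i)"
      using f(2)[OF nth_in[OF i]] sum_nth[of "\<lambda>v. (adjacency G (vs ! i) v - d / n) * f v"]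
      by (simp add: kernel_op_def)
    finally show "(N *\<^sub>v w) $ i = (\<mu> \<cdot>\<^sub>v w) $ i"
      using i by (simp add: w_def)
  qed (simp add: N_def w_def)
  moreover have "w \<noteq> 0\<^sub>v n"
  proof
    assume "w = 0\<^sub>v n"
    then have "f (vs ! i) = 0" if "i < n" for i
      using that by (metis index_vec index_zero_vec(1) w_def)
    then show False
      using f(1) vs len by (metis in_set_conv_nth)
  qed
  ultimately have "eigenvalue N \<mu>"
    unfolding eigenvalue_def eigenvector_def by (intro exI[of _ w]) (auto simp: w_def N_def)
  then have "poly (char_poly Q) \<mu> = 0"
    using \<open>\<mu> \<noteq> 0\<close> by (simp add: eigenvalue_root_char_poly[OF N] cpN)
  moreover have Q0: "char_poly Q \<noteq> 0"
    using degree_monic_char_poly[of Q n'] by (auto simp: Q_def)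
  ultimately have "\<mu> \<in># proots (char_poly Q)" by simp
  moreover have "proots (char_poly M) = {#real d#} + proots (char_poly Q)"
    unfolding cpM using Q0 by (subst proots_mult) auto
  ultimately have "\<mu> \<in># proots (char_poly M) - {#real d#}" by simp
  then show ?thesis
    using G vs by (auto simp: ndl_graph_def M_def)
qed

text \<open>The extremal eigenvalue of the centered kernel is the operator norm up to sign, and
  \<open>lam\<close> bounds it once it is known to be nonzero. Nonnegativity of \<open>lam\<close>
  is not built into \<open>ndl_graph\<close> and is obtained here as well.\<close>

lemma ndl_graph_centered_bound:
  assumes G: "ndl_graph n d lam G" and "d > 0" and "pverts G \<noteq> {}"
  shows "0 \<le> lam"
    and "L2_set (kernel_op (pverts G) (\<lambda>u v. adjacency G u v - d / n) g) (pverts G)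
           \<le> lam * L2_set g (pverts G)"
proof -
  let ?V = "pverts G"
  let ?E = "\<lambda>u v. adjacency G u v - d / n"
  have fin: "finite ?V" by (rule ndl_graph_finite[OF G])
  have sym: "?E u v = ?E v u" if "u \<in> ?V" "v \<in> ?V" for u v
    by (simp only: ndl_graph_symmetric[OF G, of u v])
  obtain f \<mu> where \<mu>: "\<exists>u\<in>?V. f u \<noteq> 0" "\<forall>u\<in>?V. kernel_op ?V ?E f u = \<mu> * f u"
    "\<forall>g. L2_set (kernel_op ?V ?E g) ?V \<le> \<bar>\<mu>\<bar> * L2_set g ?V"
    by (rule symmetric_kernel_extremal_eigenvalue[OF fin \<open>?V \<noteq> {}\<close> sym])
  obtain v where v: "v \<in> ?V" using \<open>?V \<noteq> {}\<close> by blast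
  \<comment> \<open>Otherwise the operator vanishes, but without loops its diagonal entries are - d
    / n.\<close>
  have "\<mu> \<noteq> 0"
  proof
    assume "\<mu> = 0"
    then have "L2_set (kernel_op ?V ?E (\<lambda>u. of_bool (u = v))) ?V \<le> 0"
      using \<mu>(3)[rule_format, of "\<lambda>u. of_bool (u = v)"] by simp
    then have "L2_set (kernel_op ?V ?E (\<lambda>u. of_bool (u = v))) ?V = 0"
      by (rule order_antisym[OF _ L2_set_nonneg])
    then have "?E v v = 0"
      using fin v by (simp add: L2_set_eq_0_iff kernel_op_point_mass del: of_bool_eq)
    moreover have "n > 0" using G v fin by (auto simp: ndl_graph_def card_gt_0_iff)
    ultimately show False using \<open>d > 0\<close> ndl_graph_loopfree[OF G, of v] by simp
  qed
  then have le: "\<bar>\<mu>\<bar> \<le> lam"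
    using ndl_graph_nontrivial_eigenvalue[OF G _ \<mu>(1)] \<mu>(2) by blast
  then show "0 \<le> lam" by linarith
  show "L2_set (kernel_op ?V ?E g) ?V \<le> lam * L2_set g ?V"
    using \<mu>(3)[rule_format, of g] mult_right_mono[OF le L2_set_nonneg[of g ?V]] by linarith
qed

text \<open>Extending \<open>f\<close> by zero keeps its norm, and restricting the output to
  \<open>S\<close> does not increase the norm.\<close>

lemma kernel_op_bound_subset:
  assumes "finite V" "S \<subseteq> V"
    and bound: "\<And>f. L2_set (kernel_op V K f) V \<le> b * L2_set f V"
  shows "L2_set (kernel_op S K f) S \<le> b * L2_set f S"
proof -
  let ?f = "\<lambda>u. if u \<in> S then f u else 0"
  have [simp]: "V \<inter> S = S" "S \<inter> V = S" using assms(2) by blast+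
  have eq: "kernel_op V K ?f = kernel_op S K f"
    using assms(1) by (simp add: kernel_op_def fun_eq_iff if_distrib[of "\<lambda>x. _ * x"] sum.If_cases
        cong: if_cong)
  have "L2_set (kernel_op S K f) S \<le> L2_set (kernel_op V K ?f) V"
    unfolding eq L2_set_def using assms(1,2) by (intro real_sqrt_le_mono sum_mono2) auto
  also have "\<dots> \<le> b * L2_set ?f V" by (rule bound)
  also have "L2_set ?f V = L2_set f S"
    using assms(1) by (simp add: L2_set_def if_distrib[of "\<lambda>x. x\<^sup>2"] sum.If_cases cong: if_cong)
  finally show ?thesis .
qed

section \<open>Counting cycles\<close>

text \<open>The lists hold the \<open>k\<close> interior vertices of a walk from \<open>u\<close> to
  \<open>w\<close>, which has \<open>Suc k\<close> steps. Induction splits on the first interior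
  vertex, so \<open>u\<close> is left general.\<close>

lemma card_walks:
  assumes "finite S" and w: "w \<in> S"
  shows "real (card {xs. length xs = k \<and> set xs \<subseteq> S \<and> successively R (u # xs @ [w])})
    = (kernel_op S (\<lambda>u v. of_bool (R u v)) ^^ Suc k) (\<lambda>v. of_bool (v = w)) u"
    (is "real (card (?W k u)) = (?T ^^ _) _ _")
proof (induction k arbitrary: u)
  case 0
  have "?W 0 u = (if R u w then {[]} else {})" by auto
  then show ?case using assms by (simp add: kernel_op_point_mass)
next
  case (Suc k)
  have fin: "finite (?W k v)" for v
    by (rule finite_subset[OF _ finite_lists_length_eq[OF assms(1), of k]]) auto
  have "?W (Suc k) u = (\<Union>v\<in>{v\<in>S. R u v}. (#) v ` ?W k v)"
    by (auto simp: length_Suc_conv)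
  also have "card \<dots> = (\<Sum>v\<in>{v\<in>S. R u v}. card ((#) v ` ?W k v))"
    using assms(1) fin by (intro card_UN_disjoint) auto
  also have "\<dots> = (\<Sum>v\<in>{v\<in>S. R u v}. card (?W k v))"
    by (intro sum.cong refl card_image) simp
  finally have "real (card (?W (Suc k) u)) = (\<Sum>v\<in>{v\<in>S. R u v}. real (card (?W k v)))" by simp
  also have "\<dots> = (\<Sum>v\<in>S. of_bool (R u v) * (?T ^^ Suc k) (\<lambda>v. of_bool (v = w)) v)"
    using assms(1) by (simp only: Suc.IH) (auto intro!: sum.mono_neutral_cong_left)
  finally show ?case by (simp add: kernel_op_def)
qed

lemma successively_closed_iff:
  assumes "length xs = m" "m > 0"
  shows "(\<forall>i<m. R (xs ! i) (xs ! (Suc i mod m))) \<longleftrightarrow> successively R (xs @ [hd xs])"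
proof -
  have [simp]: "hd xs = xs ! 0" using assms by (cases xs) auto
  have "(xs @ [hd xs]) ! i = xs ! i" "(xs @ [hd xs]) ! Suc i = xs ! (Suc i mod m)" if "i < m" for i
    using assms that
    by (auto simp: nth_append not_less less_Suc_eq_le mod_Suc dest: le_antisym)
  then show ?thesis
    using assms by (auto simp: successively_conv_nth)
qed

text \<open>Sorting cycles by their first vertex \<open>w\<close> leaves closed walks at
  \<open>w\<close> with \<open>m - 1\<close> interior vertices, which the diagonal entry at
  \<open>w\<close> counts.\<close>

lemma card_cycles_in:
  assumes "finite U" "m > 0"
  shows "real (card (cycles_in G U m))
    = (\<Sum>w\<in>U. (kernel_op U (adjacency G) ^^ m) (\<lambda>v. of_bool (v = w)) w)"
proof -
  obtain k where m: "m = Suc k" using assms(2) by (cases m) auto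
  let ?R = "\<lambda>u v. (u, v) \<in> parcs G"
  let ?W = "\<lambda>w. {xs. length xs = k \<and> set xs \<subseteq> U \<and> successively ?R (w # xs @ [w])}"
  have fin: "finite (?W v)" for v
    by (rule finite_subset[OF _ finite_lists_length_eq[OF assms(1), of k]]) auto
  have "cycles_in G U m = {vs. length vs = m \<and> set vs \<subseteq> U \<and> successively ?R (vs @ [hd vs])}"
    unfolding cycles_in_def using successively_closed_iff[OF _ assms(2), of _ ?R] by blast
  also have "\<dots> = (\<Union>w\<in>U. (#) w ` ?W w)"
    by (auto simp: m length_Suc_conv)
  also have "card \<dots> = (\<Sum>w\<in>U. card ((#) w ` ?W w))"
    using assms(1) fin by (intro card_UN_disjoint) auto
  also have "\<dots> = (\<Sum>w\<in>U. card (?W w))"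
    by (intro sum.cong refl card_image) simp
  finally have "real (card (cycles_in G U m)) = (\<Sum>w\<in>U. real (card (?W w)))" by simp
  also have "\<dots> = (\<Sum>w\<in>U. (kernel_op U (adjacency G) ^^ m) (\<lambda>v. of_bool (v = w)) w)"
    unfolding m by (intro sum.cong refl card_walks[OF assms(1)])
  finally show ?thesis .
qed

section \<open>The trace estimate for a vertex subset of a regular graph\<close>

lemma ndl_graph_cycle_count:
  fixes lam :: real
  assumes G: "ndl_graph n d lam G" and "d > 0" and U: "U \<subseteq> pverts G" "U \<noteq> {}" and "m \<ge> 2"
    and lam_le: "lam \<le> d / n * card U"
  shows "\<bar>real (card (cycles_in G U m)) - (d / n * card U) ^ m\<bar>
    \<le> m * 2 ^ m * lam * (d / n * card U) ^ (m - 1) + 3 * lam ^ (m - 2) * (card U)\<^sup>2 * (d / n)"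
proof -
  let ?V = "pverts G" and ?c = "d / n :: real"
  let ?E = "\<lambda>u v. adjacency G u v - ?c"
  have fin: "finite ?V" by (rule ndl_graph_finite[OF G])
  have finU: "finite U" using U fin finite_subset by blast
  have V: "?V \<noteq> {}" using U by blast
  have card: "card ?V = n" using G by (simp add: ndl_graph_def)
  then have n: "n > 0" using V fin by (auto simp: card_gt_0_iff)
  note lam0 = ndl_graph_centered_bound(1)[OF G \<open>d > 0\<close> V]
  have sym: "?E u v = ?E v u" for u v by (simp only: ndl_graph_symmetric[OF G, of u v])
  interpret constant_perturbation U "adjacency G" ?E ?c lam
  proof
    show "L2_set (kernel_op U ?E f) U \<le> lam * L2_set f U" for f
      by (rule kernel_op_bound_subset[OF fin U(1)]) (rule ndl_graph_centered_bound(2)[OF G \<open>d > 0\<close> V])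
  qed (use finU lam0 lam_le sym in auto)
  obtain v where v: "v \<in> ?V" using V by blast
  have "real d \<le> n"
    using ndl_graph_row_sum[OF G v] sum_mono[of ?V "adjacency G v" "\<lambda>_. 1"] card by simp
  then have c1: "?c \<le> 1" using n by simp
  have "?c\<^sup>2 \<le> ?c" using c1 c_nonneg power_decreasing[of 1 2 ?c] by simp
  \<comment> \<open>Since \<open>c\<^sup>2\<close> is at most \<open>c\<close>, the squared entries
    of the centered kernel are dominated by a kernel linear in adjacency, whose sum over
    \<open>U\<close> is an edge count.\<close>
  moreover have "(of_bool P - c)\<^sup>2 \<le> of_bool P + c" if "c\<^sup>2 \<le> c" "0 \<le> c" for P and c :: real
    using that by (cases P) (auto simp: power2_diff)
  ultimately have "(?E u w)\<^sup>2 \<le> adjacency G u w + ?c" for u w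
    using c_nonneg by blast
  then have "(\<Sum>w\<in>U. \<Sum>u\<in>U. (?E u w)\<^sup>2) \<le> (\<Sum>w\<in>U. \<Sum>u\<in>U. adjacency G u w + ?c)"
    by (intro sum_mono)
  also have "\<dots> = (\<Sum>w\<in>U. \<Sum>u\<in>U. adjacency G w u) + ?c * (card U)\<^sup>2"
    by (simp add: sum.distrib ndl_graph_symmetric[OF G, of _ w for w] power2_eq_square)
  \<comment> \<open>The edge count contributes 2 and the constant part 1 to the final factor
    3.\<close>
  also have "\<dots> \<le> 2 * (?c * card U) * card U + ?c * (card U)\<^sup>2"
    using sum_row_bound by simp
  also have "\<dots> = 3 * (card U)\<^sup>2 * ?c"
    by (simp add: power2_eq_square)
  finally have "lam ^ (m - 2) * (\<Sum>w\<in>U. \<Sum>u\<in>U. (?E u w)\<^sup>2) \<le> lam ^ (m - 2) * (3 * (card U)\<^sup>2 * ?c)"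
    using lam0 by (intro mult_left_mono) auto
  then show ?thesis
    using trace_power_bound[OF \<open>m \<ge> 2\<close>] card_cycles_in[OF finU, of m G] \<open>m \<ge> 2\<close>
    by (simp add: mult_ac)
qed

theorem theorem1p5:
  fixes m :: nat
    and G :: "nat \<Rightarrow> 'a pair_pre_digraph"
    and U :: "nat \<Rightarrow> 'a set"
    and n d :: "nat \<Rightarrow> nat"
    and lam :: "nat \<Rightarrow> real"
  assumes "m \<ge> 4"
    and "\<And>j. ndl_graph (n j) (d j) (lam j) (G j)"
    and "\<And>j. d j > 0"
    and "\<And>j. U j \<subseteq> pverts (G j)"
    and "\<And>j. U j \<noteq> {}"
    and "(\<lambda>j. lam j * real (n j) / (real (d j) * real (card (U j)))) \<longlonglongrightarrow> 0"
  shows "\<exists>C::real. \<forall>\<^sub>F j in sequentially.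
           \<bar>real (card (cycles_in (G j) (U j) m))
              - real (card (U j)) ^ m * real (d j) ^ m / real (n j) ^ m\<bar>
           \<le> C * (lam j * real (card (U j)) ^ (m - 1) * real (d j) ^ (m - 1) / real (n j) ^ (m - 1)
                   + lam j ^ (m - 2) * real (card (U j)) ^ 2 * real (d j) / real (n j))"
proof (intro exI)
  \<comment> \<open>The sum of the two constants in \<open>ndl_graph_cycle_count\<close>, so it
    dominates each.\<close>
  let ?C = "real (m * 2 ^ m) + 3"
  \<comment> \<open>A limit of 0 is used only through the bound 1, which says that
    \<open>lam j\<close> is below d |U| / n.\<close>
  have "\<forall>\<^sub>F j in sequentially. lam j * real (n j) / (real (d j) * real (card (U j))) < 1"
    using order_tendstoD(2)[OF assms(6), of 1] by simp
  then show "\<forall>\<^sub>F j in sequentially.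
           \<bar>real (card (cycles_in (G j) (U j) m))
              - real (card (U j)) ^ m * real (d j) ^ m / real (n j) ^ m\<bar>
           \<le> ?C * (lam j * real (card (U j)) ^ (m - 1) * real (d j) ^ (m - 1) / real (n j) ^ (m - 1)
                   + lam j ^ (m - 2) * real (card (U j)) ^ 2 * real (d j) / real (n j))"
  proof eventually_elim
    case (elim j)
    have fin: "finite (pverts (G j))" by (rule ndl_graph_finite[OF assms(2)])
    have cU: "card (U j) > 0"
      using assms(4,5) finite_subset[OF _ fin] by (simp add: card_gt_0_iff)
    have "pverts (G j) \<noteq> {}" using assms(4,5) by blast
    then have n: "n j > 0" and lam0: "0 \<le> lam j"
      using fin assms(2)[of j] ndl_graph_centered_bound(1)[OF assms(2,3)]
      by (auto simp: ndl_graph_def card_gt_0_iff)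
    have "lam j \<le> d j / n j * card (U j)"
      using elim cU n assms(3)[of j] by (simp add: field_simps)
    with ndl_graph_cycle_count[OF assms(2,3,4,5)] assms(1)
    have "\<bar>real (card (cycles_in (G j) (U j) m)) - (d j / n j * card (U j)) ^ m\<bar>
      \<le> m * 2 ^ m * lam j * (d j / n j * card (U j)) ^ (m - 1)
        + 3 * lam j ^ (m - 2) * (card (U j))\<^sup>2 * (d j / n j)"
      by simp
    moreover have "(d j / n j * card (U j)) ^ k = real (card (U j)) ^ k * real (d j) ^ k / real (n j) ^ k" for k
      by (simp add: power_mult_distrib power_divide)
    ultimately have "\<bar>real (card (cycles_in (G j) (U j) m))
          - real (card (U j)) ^ m * real (d j) ^ m / real (n j) ^ m\<bar>
      \<le> real (m * 2 ^ m) * (lam j * real (card (U j)) ^ (m - 1) * real (d j) ^ (m - 1) / real (n j) ^ (m - 1))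
        + 3 * (lam j ^ (m - 2) * real (card (U j)) ^ 2 * real (d j) / real (n j))" (is "_ \<le> _ * ?a + _ * ?b")
      by (simp add: mult_ac)
    also have "\<dots> \<le> ?C * ?a + ?C * ?b"
      using lam0 by (intro add_mono mult_right_mono) auto
    finally show ?case by (simp only: distrib_left)
  qed
qed

end
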